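(* Let $V$ be a valuation domain of rank one with quotient field $K$, and let $\delta\in\mathbb{R}\cup\{\infty\}$. On $\mathcal{V}(\bullet,\delta)$, the Zariski topology, the constructible topology (both as subspace topologies from $\mathrm{Zar}(K(X)|V)$) and the topology induced by the metric $d_\delta$ coincide.
   Context: $\mathrm{Zar}(K(X)|V)$ is the set of valuation domains of $K(X)$ (with quotient field $K(X)$) containing $V$. Its Zariski topology is generated by the subbasic open sets $B(\phi)=\{W\mid\phi\in W\}$, $\phi\in K(X)$; its constructible topology is the coarsest topology for which all sets $B(\phi_1)\cap\cdots\cap B(\phi_k)$ are both open and closed. $v$ is the valuation associated to $V$, with value group $\Gamma_v\subseteq\mathbb{R}$, and $d(x,y)=e^{-v(x-y)}$ for $x,y\in K$ (with $e^{-\infty}=0$). A sequence $E=\{s_n\}_{n\in\mathbb{N}}$ in $K$ is pseudo-convergent if $v(s_{n+1}-s_n)<v(s_{n+2}-s_{n+1})$ for all $n$. Its breadth is $\delta_E=\lim_{n\to\infty}v(s_{n+1}-s_n)\in\mathbb{R}\cup\{\infty\}$. For a pseudo-convergent sequence $E$, $V_E=\{\phi\in K(X)\mid \phi(s_n)\in V\text{ for all but finitely many }n\in\mathbb{N}\}$; this is a valuation domain of $K(X)$ with $V_E\cap K=V$. $\mathcal{V}(\bullet,\delta)$ is the set of rings $V_E$, where $E$ ranges over the pseudo-convergent sequences in $K$ of breadth $\delta$. The metric $d_\delta$ on $\mathcal{V}(\bullet,\delta)$ is the (well-defined) ultrametric distance given by $d_\delta(V_E,V_F)=\lim_{n\to\infty}\max\{d(s_n,t_n)-e^{-\delta},0\}$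 for $E=\{s_n\}_{n\in\mathbb{N}}$, $F=\{t_n\}_{n\in\mathbb{N}}$ pseudo-convergent of breadth $\delta$. *)

theory Defs
  imports
    "HOL-Analysis.Analysis"
    "HOL-Computational_Algebra.Polynomial_Factorial"
begin

text \<open>
  The field \<open>K\<close> is the type \<open>'a::field\<close> and \<open>K(X)\<close> is \<open>'a poly fract\<close>. Subrings of these
  fields, in particular valuation domains, are represented by their carrier sets.
\<close>

section \<open>Valuation domains, rank, and the associated valuation\<close>

text \<open>Valuation domains whose quotient field is the whole ambient field;
  the latter follows from the last conjunct, see the lemma below.\<close>

definition valuation_domain :: "'k::field set \<Rightarrow> bool" where
  "valuation_domain W \<longleftrightarrow>
     0 \<in> W \<and> 1 \<in> W \<and>
     (\<forall>x\<in>W. \<forall>y\<in>W. x - y \<in> W) \<and>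
     (\<forall>x\<in>W. \<forall>y\<in>W. x * y \<in> W) \<and>
     (\<forall>x. x \<noteq> 0 \<longrightarrow> x \<in> W \<or> inverse x \<in> W)"

lemma valuation_domain_quotient_field:
  assumes "valuation_domain W"
  shows "\<exists>a\<in>W. \<exists>b\<in>W. b \<noteq> 0 \<and> x = a / b"
proof (cases "x \<in> W")
  case True
  then show ?thesis
    using assms unfolding valuation_domain_def by (intro bexI[of _ x] bexI[of _ 1]) auto
next
  case False
  then have x: "x \<noteq> 0" "inverse x \<in> W" and "1 \<in> W"
    using assms unfolding valuation_domain_def by metis+
  from x have "inverse x \<noteq> 0 \<and> x = 1 / inverse x"
    by (simp add: divide_inverse)
  then show ?thesis
    using x \<open>1 \<in> W\<close> by blast
qed

definition prime_ideal_in :: "'k::field set \<Rightarrow> 'k set \<Rightarrow> bool" where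
  "prime_ideal_in W P \<longleftrightarrow>
     P \<subseteq> W \<and> 0 \<in> P \<and> 1 \<notin> P \<and>
     (\<forall>x\<in>P. \<forall>y\<in>P. x - y \<in> P) \<and>
     (\<forall>x\<in>W. \<forall>y\<in>P. x * y \<in> P) \<and>
     (\<forall>x\<in>W. \<forall>y\<in>W. x * y \<in> P \<longrightarrow> x \<in> P \<or> y \<in> P)"

text \<open>The rank of a valuation domain is its Krull dimension.\<close>

definition valuation_rank :: "'k::field set \<Rightarrow> enat" where
  "valuation_rank W =
     (SUP n \<in> {n. \<exists>P :: nat \<Rightarrow> 'k set.
                    (\<forall>i\<le>n. prime_ideal_in W (P i)) \<and> (\<forall>i<n. P i \<subset> P (Suc i))}. enat n)"

text \<open>Valuations of \<open>K\<close> with value group inside \<open>\<real>\<close> (and \<open>v 0 = \<infinity>\<close>), with valuation ring \<open>V\<close>.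
  For \<open>V\<close> of rank one they are determined by \<open>V\<close> up to a positive factor.\<close>

definition associated_valuation :: "'k::field set \<Rightarrow> ('k \<Rightarrow> ereal) \<Rightarrow> bool" where
  "associated_valuation V v \<longleftrightarrow>
     v 0 = \<infinity> \<and>
     (\<forall>x. x \<noteq> 0 \<longrightarrow> \<bar>v x\<bar> \<noteq> \<infinity>) \<and>
     (\<forall>x y. v (x * y) = v x + v y) \<and>
     (\<forall>x y. min (v x) (v y) \<le> v (x + y)) \<and>
     V = {x. 0 \<le> v x}"


section \<open>The space \<open>Zar(K(X)|V)\<close> and its topologies\<close>

definition Zar :: "'a::field set \<Rightarrow> 'a poly fract set set" where
  "Zar V = {W. valuation_domain W \<and> (\<lambda>c. to_fract [:c:]) ` V \<subseteq> W}"

definition Zar_basic :: "'a::field set \<Rightarrow> 'a poly fract \<Rightarrow> 'a poly fract set set" where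
  "Zar_basic V \<phi> = {W \<in> Zar V. \<phi> \<in> W}"

definition zariski_topology :: "'a::field set \<Rightarrow> 'a poly fract set topology" where
  "zariski_topology V = topology_generated_by (range (Zar_basic V))"

definition Zar_basic_inters :: "'a::field set \<Rightarrow> 'a poly fract set set set" where
  "Zar_basic_inters V = {(\<Inter>\<phi>\<in>F. Zar_basic V \<phi>) | F. finite F \<and> F \<noteq> {}}"

text \<open>The coarsest topology in which the sets \<open>Zar_basic_inters V\<close> are open and closed is
  generated by these sets and their complements; see the two lemmas below.\<close>

definition constructible_topology :: "'a::field set \<Rightarrow> 'a poly fract set topology" where
  "constructible_topology V =
     topology_generated_by (Zar_basic_inters V \<union> (\<lambda>B. Zar V - B) ` Zar_basic_inters V)"

lemma Zar_in_basic_inters: "Zar V \<in> Zar_basic_inters V"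
proof -
  have "Zar V = (\<Inter>\<phi>\<in>{0}. Zar_basic V \<phi>)"
    by (auto simp: Zar_basic_def Zar_def valuation_domain_def)
  then show ?thesis
    unfolding Zar_basic_inters_def by blast
qed

lemma Zar_basic_inters_subset: "B \<in> Zar_basic_inters V \<Longrightarrow> B \<subseteq> Zar V"
  by (auto simp: Zar_basic_inters_def Zar_basic_def)

lemma topspace_zariski_topology [simp]: "topspace (zariski_topology V) = Zar V"
proof -
  have "Zar V \<subseteq> Zar_basic V 0"
    by (auto simp: Zar_basic_def Zar_def valuation_domain_def)
  then show ?thesis
    by (auto simp: zariski_topology_def Zar_basic_def)
qed

lemma topspace_constructible_topology [simp]: "topspace (constructible_topology V) = Zar V"
  using Zar_in_basic_inters[of V] Zar_basic_inters_subset[of _ V]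
  by (auto simp: constructible_topology_def)

lemma constructible_topology_clopen:
  assumes "B \<in> Zar_basic_inters V"
  shows "openin (constructible_topology V) B \<and> closedin (constructible_topology V) B"
proof -
  have "openin (constructible_topology V) B" "openin (constructible_topology V) (Zar V - B)"
    using assms unfolding constructible_topology_def
    by (auto intro!: topology_generated_by_Basis)
  then show ?thesis
    using assms by (auto simp: closedin_def Zar_basic_inters_subset)
qed

lemma constructible_topology_coarsest:
  assumes "topspace T = Zar V"
    and "\<And>B. B \<in> Zar_basic_inters V \<Longrightarrow> openin T B \<and> closedin T B"
    and "openin (constructible_topology V) U"
  shows "openin T U"
proof (rule generate_topology_on_coarsest)
  show "istopology (openin T)"
    by simp
  show "generate_topology_on
      (Zar_basic_inters V \<union> (\<lambda>B. Zar V - B) ` Zar_basic_inters V) U"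
    using assms(3) by (simp add: constructible_topology_def openin_topology_generated_by_iff)
qed (use assms(1,2) in \<open>auto simp: closedin_def\<close>)


section \<open>Pseudo-convergent sequences and the rings \<open>V\<^sub>E\<close>\<close>

definition pseudo_convergent :: "('k::field \<Rightarrow> ereal) \<Rightarrow> (nat \<Rightarrow> 'k) \<Rightarrow> bool" where
  "pseudo_convergent v s \<longleftrightarrow>
     (\<forall>n. v (s (Suc n) - s n) < v (s (Suc (Suc n)) - s (Suc n)))"

definition breadth :: "('k::field \<Rightarrow> ereal) \<Rightarrow> (nat \<Rightarrow> 'k) \<Rightarrow> ereal" where
  "breadth v s = lim (\<lambda>n. v (s (Suc n) - s n))"

text \<open>\<open>ratfun_value \<phi> x y\<close>: the rational function \<open>\<phi>\<close> is defined at \<open>x\<close>, with value \<open>y\<close>.\<close>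

definition ratfun_value :: "'a::field poly fract \<Rightarrow> 'a \<Rightarrow> 'a \<Rightarrow> bool" where
  "ratfun_value \<phi> x y \<longleftrightarrow>
     (\<exists>p q. \<phi> = Fract p q \<and> poly q x \<noteq> 0 \<and> y = poly p x / poly q x)"

lemma ratfun_value_unique:
  assumes "ratfun_value \<phi> x y" "ratfun_value \<phi> x z"
  shows "y = z"
proof -
  obtain p q p' q' where *: "\<phi> = Fract p q" "poly q x \<noteq> 0" "y = poly p x / poly q x"
    "\<phi> = Fract p' q'" "poly q' x \<noteq> 0" "z = poly p' x / poly q' x"
    using assms unfolding ratfun_value_def by blast
  then have "q \<noteq> 0" "q' \<noteq> 0" by auto
  then have "p * q' = p' * q"
    using * by (simp add: eq_fract)
  then have "poly p x * poly q' x = poly p' x * poly q x"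
    by (metis poly_mult)
  then show ?thesis
    using * by (simp add: frac_eq_eq)
qed

definition pc_ring :: "'a::field set \<Rightarrow> (nat \<Rightarrow> 'a) \<Rightarrow> 'a poly fract set" where
  "pc_ring V s = {\<phi>. \<forall>\<^sub>F n in sequentially. \<exists>y\<in>V. ratfun_value \<phi> (s n) y}"

definition pc_rings ::
    "'a::field set \<Rightarrow> ('a \<Rightarrow> ereal) \<Rightarrow> ereal \<Rightarrow> 'a poly fract set set" where
  "pc_rings V v \<delta> = {pc_ring V s | s. pseudo_convergent v s \<and> breadth v s = \<delta>}"


section \<open>The metric \<open>d\<^sub>\<delta>\<close>\<close>

definition exp_minus :: "ereal \<Rightarrow> real" where
  "exp_minus a = (if a = \<infinity> then 0 else exp (- real_of_ereal a))"

definition val_dist :: "('k::field \<Rightarrow> ereal) \<Rightarrow> 'k \<Rightarrow> 'k \<Rightarrow> real" where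
  "val_dist v x y = exp_minus (v (x - y))"

text \<open>The distance of two points of \<open>pc_rings V v \<delta>\<close> is the common limit obtained from all
  pairs of representing sequences. Outside \<open>pc_rings V v \<delta>\<close> it is set to \<open>0\<close>, because the
  locale \<^locale>\<open>Metric_space\<close> demands symmetry and nonnegativity on the whole type.\<close>

definition pc_dist ::
    "'a::field set \<Rightarrow> ('a \<Rightarrow> ereal) \<Rightarrow> ereal \<Rightarrow> 'a poly fract set \<Rightarrow> 'a poly fract set \<Rightarrow> real"
  where
  "pc_dist V v \<delta> W W' =
     (if W \<in> pc_rings V v \<delta> \<and> W' \<in> pc_rings V v \<delta> then
        (THE r. \<forall>s t.
           pseudo_convergent v s \<and> breadth v s = \<delta> \<and> W = pc_ring V s \<and>
           pseudo_convergent v t \<and> breadth v t = \<delta> \<and> W' = pc_ring V t \<longrightarrow>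
           (\<lambda>n. max (val_dist v (s n) (t n) - exp_minus \<delta>) 0) \<longlonglongrightarrow> r)
      else 0)"

end

(*
  In terms of the absolute value |x| = exp(-v(x)), the central point is that membership of a
  rational function in V_E depends only on a neighbourhood of E. The Newton polygon of a polynomial f
  along the nested discs around s_n of radius |s_{n+1} - s_n| finally has a single slope m, so that
  |f(t)| = b |t - s_n|^m for all t in the annuli between these discs. For a quotient of two
  polynomials the condition |f(t)| <= |g(t)| then compares two monomials in |t - s_n|, and its truth
  value is constant once |t - s_n| is close to exp(-delta). A sequence F of breadth delta close to E
  eventually runs through these annuli. Hence the sets B(phi) are open and closed for the metric.
  Conversely, (X - s_n) / (s_{n+1} - s_n) lies in V_F exactly when F eventually lies in the n-th
  disc, so metric balls contain Zariski neighbourhoods.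
*)
theory Submission
  imports Defs
begin

section \<open>Non-archimedean absolute values\<close>

text \<open>The valuation in multiplicative form, with \<open>N x\<close> in the role of exp(-v(x)).
  Infinite values become the real number 0, so breadth \<infinity> turns into radius 0 and needs no
  separate treatment.\<close>

locale nonarch_abs =
  fixes N :: "'a::field \<Rightarrow> real"
  assumes N_0 [simp]: "N 0 = 0"
    and N_pos: "x \<noteq> 0 \<Longrightarrow> 0 < N x"
    and N_mult: "N (x * y) = N x * N y"
    and N_add: "N (x + y) \<le> max (N x) (N y)"
begin

lemma N_nonneg [simp]: "0 \<le> N x"
  using N_pos[of x] by (cases "x = 0") auto

lemma N_eq_0_iff [simp]: "N x = 0 \<longleftrightarrow> x = 0"
  using N_pos[of x] by (cases "x = 0") auto

lemma N_1 [simp]: "N 1 = 1"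
  using N_mult[of 1 1] N_pos[of 1] by simp

lemma N_minus [simp]: "N (- x) = N x"
proof -
  have "N (-1) * N (-1) = 1"
    using N_mult[of "-1" "-1"] by simp
  then have "N (-1) = 1"
    using N_nonneg[of "-1"] by (simp add: square_eq_1_iff)
  then show ?thesis
    using N_mult[of "-1" x] by simp
qed

lemma N_diff: "N (x - y) \<le> max (N x) (N y)"
  using N_add[of x "- y"] by simp

lemma N_minus_commute: "N (x - y) = N (y - x)"
  using N_minus[of "x - y"] by simp

lemma N_ultra: "N (x - z) \<le> max (N (x - y)) (N (y - z))"
  using N_add[of "x - y" "y - z"] by simp

text \<open>In x = (x + y) - y the summand y is too small to account for \<open>N x\<close>, so x +
  y must.\<close>

lemma N_add_eq: "N y < N x \<Longrightarrow> N (x + y) = N x"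
  using N_add[of x y] N_diff[of "x + y" y] by (auto simp: max_def split: if_splits)

lemma N_power: "N (x ^ n) = N x ^ n"
  by (induction n) (auto simp: N_mult)

lemma N_divide: "y \<noteq> 0 \<Longrightarrow> N (x / y) = N x / N y"
  using N_mult[of "x / y" y] by (simp add: field_simps)

text \<open>Makes binomial coefficients harmless in Taylor expansions, whatever the residue
  characteristic.\<close>

lemma N_of_nat_le: "N (of_nat n) \<le> 1"
proof (induction n)
  case (Suc n)
  then show ?case
    using N_add[of 1 "of_nat n"] by simp
qed simp

lemma N_sum_le:
  assumes "finite A" "A \<noteq> {}"
  shows "\<exists>j\<in>A. N (sum f A) \<le> N (f j)"
  using assms
proof (induction A rule: finite_ne_induct)
  case (insert x A)
  then show ?case
    using N_add[of "f x" "sum f A"] by (fastforce simp: max_def split: if_splits)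
qed simp


section \<open>Dominant coefficients\<close>

text \<open>The dominant index of a polynomial at radius \<open>r\<close> is the degree of its reduction modulo the
  maximal ideal after rescaling the closed disc of radius \<open>r\<close> to the unit disc.\<close>

definition dominant :: "'a poly \<Rightarrow> real \<Rightarrow> nat \<Rightarrow> bool" where
  "dominant f r m \<longleftrightarrow>
     (\<forall>i<m. N (coeff f i) * r ^ i \<le> N (coeff f m) * r ^ m) \<and>
     (\<forall>i>m. N (coeff f i) * r ^ i < N (coeff f m) * r ^ m)"

text \<open>Among the finitely many indices up to the degree, the largest one that attains the
  maximum of the rescaled coefficients is dominant.\<close>

lemma dominant_exists:
  assumes "f \<noteq> 0" "0 < r"
  shows "\<exists>m. dominant f r m"
proof -
  define h where "h i = N (coeff f i) * r ^ i" for i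
  define M where "M = Max (h ` {..degree f})"
  have le: "h i \<le> M" if "i \<le> degree f" for i
    unfolding M_def using that by (intro Max_ge) auto
  have "M \<in> h ` {..degree f}"
    unfolding M_def by (intro Max_in) auto
  then obtain i0 where i0: "i0 \<le> degree f" "h i0 = M"
    by auto
  \<comment> \<open>Positivity of the maximum makes the vanishing coefficients beyond the degree
    strictly smaller.\<close>
  have "0 < h (degree f)"
    using assms by (auto simp: h_def intro!: mult_pos_pos N_pos)
  then have "0 < M"
    using le[of "degree f"] by simp
  define m where "m = (GREATEST i. i \<le> degree f \<and> h i = M)"
  have m: "m \<le> degree f" "h m = M"
    using GreatestI_nat[of "\<lambda>i. i \<le> degree f \<and> h i = M" i0 "degree f"] i0 by (auto simp: m_def)
  have ub: "i \<le> m" if "i \<le> degree f" "h i = M" for i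
    unfolding m_def using Greatest_le_nat[of "\<lambda>i. i \<le> degree f \<and> h i = M" i "degree f"] that by auto
  have "h i < h m" if "i > m" for i
  proof (cases "i \<le> degree f")
    case True
    then show ?thesis
      using le[of i] ub[of i] m that by (metis leD order_le_less)
  next
    case False
    then show ?thesis
      using \<open>0 < M\<close> m by (simp add: h_def coeff_eq_0)
  qed
  moreover have "h i \<le> h m" if "i < m" for i
    using le[of i] m that by simp
  ultimately show ?thesis
    unfolding dominant_def h_def by blast
qed

lemma dominant_pos:
  assumes "dominant f r m" "0 < r"
  shows "0 < N (coeff f m)"
proof -
  have "0 \<le> N (coeff f (Suc m)) * r ^ Suc m"
    using assms by (intro mult_nonneg_nonneg) auto
  also have "\<dots> < N (coeff f m) * r ^ m"
    using assms(1) lessI[of m] unfolding dominant_def by metis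
  finally show ?thesis
    using assms by (simp add: zero_less_mult_iff)
qed

section \<open>Coefficients under a change of centre\<close>

lemma coeff_pcompose_linear:
  fixes f :: "'b::comm_ring_1 poly"
  assumes "degree f \<le> d"
  shows "coeff (f \<circ>\<^sub>p [:c, 1:]) i = (\<Sum>j=i..d. coeff f j * (of_nat (j choose i) * c ^ (j - i)))"
proof -
  have co: "coeff ([:c, 1:] ^ j) i = of_nat (j choose i) * c ^ (j - i)" for j
  proof (cases "i \<le> j")
    case False
    then have "degree ([:c, 1:] ^ j) < i"
      using degree_power_le[of "[:c, 1:]" j] by simp
    then show ?thesis
      using False by (simp add: coeff_eq_0 binomial_eq_0)
  qed (simp add: coeff_linear_poly_power)
  have pc: "monom a j \<circ>\<^sub>p [:c, 1:] = smult a ([:c, 1:] ^ j)" for a j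
    by (induction j) (simp_all add: monom_0 monom_Suc pcompose_pCons)
  have "f = (\<Sum>j\<le>d. monom (coeff f j) j)"
    using poly_as_sum_of_monoms'[OF assms] by simp
  then have "f \<circ>\<^sub>p [:c, 1:] = (\<Sum>j\<le>d. monom (coeff f j) j) \<circ>\<^sub>p [:c, 1:]"
    by simp
  also have "\<dots> = (\<Sum>j\<le>d. smult (coeff f j) ([:c, 1:] ^ j))"
    by (simp add: pcompose_sum pc)
  finally have "coeff (f \<circ>\<^sub>p [:c, 1:]) i = (\<Sum>j\<le>d. coeff f j * (of_nat (j choose i) * c ^ (j - i)))"
    by (simp add: coeff_sum co)
  also have "\<dots> = (\<Sum>j=i..d. coeff f j * (of_nat (j choose i) * c ^ (j - i)))"
    by (intro sum.mono_neutral_right) (auto simp: binomial_eq_0)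
  finally show ?thesis .
qed

text \<open>The binomial coefficient has absolute value at most 1, and the power of c costs at most
  r^(j - i), exactly what r^i lacks to r^j.\<close>

lemma shift_term_le:
  assumes "N c \<le> r" "i \<le> j"
  shows "N (coeff f j * (of_nat (j choose i) * c ^ (j - i))) * r ^ i \<le> N (coeff f j) * r ^ j"
proof -
  have r: "0 \<le> r"
    using assms(1) N_nonneg[of c] by linarith
  have "N (of_nat (j choose i) * c ^ (j - i)) \<le> 1 * r ^ (j - i)"
    unfolding N_mult N_power using assms r by (intro mult_mono power_mono N_of_nat_le) auto
  then have "N (coeff f j * (of_nat (j choose i) * c ^ (j - i))) * r ^ i
      \<le> N (coeff f j) * r ^ (j - i) * r ^ i"
    using r by (subst N_mult) (auto intro!: mult_right_mono mult_left_mono)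
  also have "\<dots> = N (coeff f j) * r ^ j"
    using assms(2) by (simp add: mult.assoc flip: power_add)
  finally show ?thesis .
qed

lemma coeff_shift_le:
  assumes "N c \<le> r"
  shows "\<exists>j\<ge>i. N (coeff (f \<circ>\<^sub>p [:c, 1:]) i) * r ^ i \<le> N (coeff f j) * r ^ j"
proof -
  \<comment> \<open>The upper summation bound may exceed the degree; here it also keeps the index
    range nonempty, as \<open>N_sum_le\<close> requires.\<close>
  define d where "d = max i (degree f)"
  obtain j where j: "j \<in> {i..d}"
    "N (coeff (f \<circ>\<^sub>p [:c, 1:]) i) \<le> N (coeff f j * (of_nat (j choose i) * c ^ (j - i)))"
    using N_sum_le[of "{i..d}" "\<lambda>j. coeff f j * (of_nat (j choose i) * c ^ (j - i))"]
      coeff_pcompose_linear[of f d c i] by (auto simp: d_def)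
  have "0 \<le> r"
    using assms N_nonneg[of c] by linarith
  then have "N (coeff (f \<circ>\<^sub>p [:c, 1:]) i) * r ^ i \<le> N (coeff f j) * r ^ j"
    using mult_right_mono[OF j(2), of "r ^ i"] shift_term_le[OF assms, of i j f] j(1) by force
  then show ?thesis
    using j by auto
qed

text \<open>The term j = i of the Taylor expansion is the old coefficient, so only strictly higher
  indices contribute to the change.\<close>

lemma coeff_shift_diff_le:
  assumes "N c \<le> r"
  shows "\<exists>j>i. N (coeff (f \<circ>\<^sub>p [:c, 1:]) i - coeff f i) * r ^ i \<le> N (coeff f j) * r ^ j"
proof -
  define d where "d = max (Suc i) (degree f)"
  have "coeff (f \<circ>\<^sub>p [:c, 1:]) i - coeff f i
      = (\<Sum>j=Suc i..d. coeff f j * (of_nat (j choose i) * c ^ (j - i)))"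
    using coeff_pcompose_linear[of f d c i]
    by (simp add: d_def sum.atLeast_Suc_atMost)
  then obtain j where j: "j \<in> {Suc i..d}"
    "N (coeff (f \<circ>\<^sub>p [:c, 1:]) i - coeff f i) \<le> N (coeff f j * (of_nat (j choose i) * c ^ (j - i)))"
    using N_sum_le[of "{Suc i..d}" "\<lambda>j. coeff f j * (of_nat (j choose i) * c ^ (j - i))"]
    by (auto simp: d_def)
  have "0 \<le> r"
    using assms N_nonneg[of c] by linarith
  then have "N (coeff (f \<circ>\<^sub>p [:c, 1:]) i - coeff f i) * r ^ i \<le> N (coeff f j) * r ^ j"
    using mult_right_mono[OF j(2), of "r ^ i"] shift_term_le[OF assms, of i j f] j(1) by force
  then show ?thesis
    using j by (auto simp: Suc_le_eq)
qed

text \<open>Recentring inside the disc changes a coefficient only through higher ones. At m and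
  above, these are strictly below the dominant term; below m, the weak bound survives.\<close>

lemma dominant_shift:
  assumes "dominant f r m" "N c \<le> r" "0 < r"
  shows "N (coeff (f \<circ>\<^sub>p [:c, 1:]) m) = N (coeff f m)" "dominant (f \<circ>\<^sub>p [:c, 1:]) r m"
proof -
  have lo: "N (coeff f i) * r ^ i \<le> N (coeff f m) * r ^ m" for i
    using assms(1) by (cases i m rule: linorder_cases) (auto simp: dominant_def intro: less_imp_le)
  have hi: "N (coeff f i) * r ^ i < N (coeff f m) * r ^ m" if "i > m" for i
    using assms(1) that by (simp add: dominant_def)
  have "N (coeff (f \<circ>\<^sub>p [:c, 1:]) m - coeff f m) * r ^ m < N (coeff f m) * r ^ m"
    using coeff_shift_diff_le[OF assms(2), of m f] hi by fastforce
  then have "N (coeff (f \<circ>\<^sub>p [:c, 1:]) m - coeff f m) < N (coeff f m)"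
    using assms(3) by simp
  from N_add_eq[OF this] show eq: "N (coeff (f \<circ>\<^sub>p [:c, 1:]) m) = N (coeff f m)"
    by simp
  show "dominant (f \<circ>\<^sub>p [:c, 1:]) r m"
    unfolding dominant_def eq
    using coeff_shift_le[OF assms(2), of _ f] lo hi
    by (meson le_less_trans less_le_trans order_trans)
qed

section \<open>Dominant monomials and changes of radius\<close>

lemma N_poly_dominant:
  assumes "\<And>i. i \<noteq> m \<Longrightarrow> N (coeff f i) * N x ^ i < N (coeff f m) * N x ^ m"
  shows "N (poly f x) = N (coeff f m) * N x ^ m"
proof -
  \<comment> \<open>With \<open>Suc m\<close> in the range, the remaining sum is nonempty and
    \<open>N_sum_le\<close> applies.\<close>
  define d where "d = max (Suc m) (degree f)"
  let ?h = "\<lambda>i. coeff f i * x ^ i"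
  have "poly f x = (\<Sum>i\<le>d. ?h i)"
    unfolding poly_altdef d_def by (intro sum.mono_neutral_left) (auto simp: coeff_eq_0)
  also have "\<dots> = ?h m + (\<Sum>i\<in>{..d} - {m}. ?h i)"
    by (intro sum.remove) (auto simp: d_def)
  finally have eq: "poly f x = ?h m + (\<Sum>i\<in>{..d} - {m}. ?h i)" .
  have "Suc m \<in> {..d} - {m}"
    by (auto simp: d_def)
  then obtain j where "j \<noteq> m" "N (\<Sum>i\<in>{..d} - {m}. ?h i) \<le> N (?h j)"
    using N_sum_le[of "{..d} - {m}" ?h] by blast
  then have "N (\<Sum>i\<in>{..d} - {m}. ?h i) < N (?h m)"
    using assms[of j] by (simp add: N_mult N_power)
  then show ?thesis
    using N_add_eq eq by (simp add: N_mult N_power)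
qed

text \<open>After division by the m-th power of the radius, the higher monomial carries a positive
  power of it, so shrinking the radius only helps m.\<close>

lemma dominant_upper_mono:
  assumes "dominant f r m" "0 < r'" "r' \<le> r" "i > m"
  shows "N (coeff f i) * r' ^ i < N (coeff f m) * r' ^ m"
proof -
  have split: "r ^ i = r ^ (i - m) * r ^ m" "r' ^ i = r' ^ (i - m) * r' ^ m"
    using assms(4) by (simp_all flip: power_add)
  have "N (coeff f i) * r ^ (i - m) < N (coeff f m)"
    using assms by (auto simp: dominant_def split)
  moreover have "N (coeff f i) * r' ^ (i - m) \<le> N (coeff f i) * r ^ (i - m)"
    using assms by (intro mult_left_mono power_mono) auto
  ultimately show ?thesis
    using assms(2) by (simp add: split)
qed

text \<open>Enlarging the radius favours the higher exponent m, and does so strictly; this turns the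
  weak inequality of \<open>dominant\<close> into a strict one.\<close>

lemma dominant_lower_mono:
  assumes "dominant f r m" "0 < r" "r < r'" "i < m"
  shows "N (coeff f i) * r' ^ i < N (coeff f m) * r' ^ m"
proof -
  have split: "r ^ m = r ^ (m - i) * r ^ i" "r' ^ m = r' ^ (m - i) * r' ^ i"
    using assms(4) by (simp_all flip: power_add)
  have "N (coeff f i) \<le> N (coeff f m) * r ^ (m - i)"
    using assms by (auto simp: dominant_def split)
  also have "\<dots> < N (coeff f m) * r' ^ (m - i)"
    using assms dominant_pos[OF assms(1,2)] by (intro mult_strict_left_mono power_strict_mono) auto
  finally show ?thesis
    using assms(2,3) by (simp add: split)
qed


section \<open>Pseudo-convergent sequences\<close>

text \<open>Pseudo-convergence in terms of \<open>N\<close>: here \<rho> stands for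
  \<open>exp_minus \<delta>\<close>, where \<delta> is the breadth.\<close>

definition pcs :: "real \<Rightarrow> (nat \<Rightarrow> 'a) \<Rightarrow> bool" where
  "pcs \<rho> s \<longleftrightarrow>
     (\<forall>n. N (s (Suc (Suc n)) - s (Suc n)) < N (s (Suc n) - s n)) \<and>
     (\<lambda>n. N (s (Suc n) - s n)) \<longlonglongrightarrow> \<rho>"

abbreviation gap :: "(nat \<Rightarrow> 'a) \<Rightarrow> nat \<Rightarrow> real" where
  "gap s n \<equiv> N (s (Suc n) - s n)"

lemma pcs_gap_less:
  assumes "pcs \<rho> s" "n < k"
  shows "gap s k < gap s n"
  using assms(2)
proof (induction rule: less_Suc_induct)
  case (1 i)
  then show ?case
    using assms(1) by (simp add: pcs_def)
qed simp

lemma pcs_gap_le: "pcs \<rho> s \<Longrightarrow> n \<le> k \<Longrightarrow> gap s k \<le> gap s n"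
  using pcs_gap_less[of \<rho> s n k] by (cases "n = k") auto

lemma pcs_gap_gt:
  assumes "pcs \<rho> s"
  shows "\<rho> < gap s n"
proof -
  \<comment> \<open>The limit yields only a weak bound; taking it one index later leaves room for a
    strict one at n.\<close>
  have "\<rho> \<le> gap s (Suc n)"
  proof (rule LIMSEQ_le_const2)
    show "gap s \<longlonglongrightarrow> \<rho>"
      using assms by (simp add: pcs_def)
    show "\<exists>M. \<forall>k\<ge>M. gap s k \<le> gap s (Suc n)"
      using pcs_gap_le[OF assms] by blast
  qed
  then show ?thesis
    using pcs_gap_less[OF assms, of n "Suc n"] by simp
qed

lemma pcs_nonneg:
  assumes "pcs \<rho> s"
  shows "0 \<le> \<rho>"
proof (rule LIMSEQ_le_const)
  show "gap s \<longlonglongrightarrow> \<rho>"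
    using assms by (simp add: pcs_def)
qed simp

lemma pcs_gap_pos: "pcs \<rho> s \<Longrightarrow> 0 < gap s n"
  using pcs_nonneg pcs_gap_gt le_less_trans by blast

lemma pcs_gap_below:
  assumes "pcs \<rho> s" "\<rho> < \<tau>"
  shows "\<exists>n. gap s n < \<tau>"
  using order_tendstoD(2)[of "gap s" \<rho> sequentially \<tau>] assms
  by (auto simp: pcs_def eventually_sequentially)

text \<open>The first step from \<open>s n\<close> is strictly longer than all later ones, so it
  alone determines the distance.\<close>

lemma pcs_dist:
  assumes "pcs \<rho> s" "n < k"
  shows "N (s k - s n) = gap s n"
proof -
  have "N (s (Suc n + j) - s n) = gap s n" for j
  proof (induction j)
    case (Suc j)
    have "gap s (Suc n + j) < gap s n"
      using assms by (intro pcs_gap_less) auto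
    then show ?case
      using N_add_eq[of "s (Suc (Suc n + j)) - s (Suc n + j)" "s (Suc n + j) - s n"] Suc by simp
  qed simp
  from this[of "k - Suc n"] show ?thesis
    using assms(2) by simp
qed

lemma pcs_dist_le:
  assumes "pcs \<rho> s" "n0 \<le> n" "n0 \<le> k"
  shows "N (s k - s n) \<le> gap s n0"
proof (cases n k rule: linorder_cases)
  case less
  then show ?thesis
    using pcs_dist[OF assms(1) less] pcs_gap_le[OF assms(1,2)] by simp
next
  case greater
  then show ?thesis
    using pcs_dist[OF assms(1) greater] pcs_gap_le[OF assms(1,3)]
    by (simp add: N_minus_commute)
qed simp

lemma pcs_inj:
  assumes "pcs \<rho> s"
  shows "inj s"
proof (rule linorder_injI)
  fix n k :: nat
  assume "n < k"
  then show "s n \<noteq> s k"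
    using pcs_dist[OF assms, of n k] pcs_gap_pos[OF assms, of n] by auto
qed

section \<open>Polynomials and rational functions along a pseudo-convergent sequence\<close>

lemma pcs_poly_nonzero:
  assumes "pcs \<rho> s" "f \<noteq> 0"
  shows "\<forall>\<^sub>F n in sequentially. poly f (s n) \<noteq> 0"
proof -
  \<comment> \<open>By injectivity of s, finitely many roots are met at finitely many indices
    only.\<close>
  have "finite (s -` {x. poly f x = 0})"
    using assms pcs_inj by (intro finite_vimageI poly_roots_finite)
  then show ?thesis
    unfolding cofinite_eq_sequentially[symmetric] eventually_cofinite by (simp add: vimage_def)
qed

text \<open>The dominant index of \<open>f\<close> on the disc around \<open>s n\<close> of radius \<open>gap s n\<close> does not depend on
  the chosen centre of the disc and decreases with \<open>n\<close>, so it becomes constant. From then on one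
  and the same monomial dominates in all the annuli between consecutive discs.\<close>

lemma pcs_poly_monomial:
  assumes s: "pcs \<rho> s" and "f \<noteq> 0"
  shows "\<exists>n0 m b. 0 < b \<and>
    (\<forall>n\<ge>n0. \<forall>t. gap s n < N (t - s n) \<longrightarrow> N (t - s n) \<le> gap s n0 \<longrightarrow>
       N (poly f t) = b * N (t - s n) ^ m)"
proof -
  \<comment> \<open>\<open>F n\<close> is the expansion of f in powers of X -
    \<open>s n\<close>.\<close>
  define F where "F n = f \<circ>\<^sub>p [:s n, 1:]" for n
  have shift: "F k = F n \<circ>\<^sub>p [:s k - s n, 1:]" for n k
    by (simp add: F_def pcompose_pCons flip: pcompose_assoc)
  have "F n \<noteq> 0" for n
    using \<open>f \<noteq> 0\<close> by (simp add: F_def pcompose_eq_0_iff)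
  then have "\<exists>m. dominant (F n) (gap s n) m" for n
    using dominant_exists pcs_gap_pos[OF s] by blast
  then obtain M where M: "dominant (F n) (gap s n) (M n)" for n
    by metis
  have trans: "dominant (F k) (gap s n) m" "N (coeff (F k) m) = N (coeff (F n) m)"
    if "dominant (F n) (gap s n) m" "n \<le> k" for n k m
    using dominant_shift[OF that(1) pcs_dist_le[OF s order_refl that(2)] pcs_gap_pos[OF s]]
    unfolding shift[of k n, symmetric] by auto
  \<comment> \<open>\<open>M n\<close> stays dominant at radius \<open>gap s n\<close> after
    recentring at \<open>s k\<close>. Shrinking the radius to \<open>gap s k\<close> keeps higher
    exponents strictly smaller, so \<open>M k\<close> cannot be one of them.\<close>
  have decr: "M k \<le> M n" if "n \<le> k" for n k
  proof (rule ccontr)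
    assume "\<not> M k \<le> M n"
    then have "N (coeff (F k) (M k)) * gap s k ^ M k < N (coeff (F k) (M n)) * gap s k ^ M n"
      using trans(1)[OF M that] pcs_gap_le[OF s that] pcs_gap_pos[OF s]
      by (intro dominant_upper_mono) auto
    then show False
      using M[of k] \<open>\<not> M k \<le> M n\<close> by (auto simp: dominant_def not_le)
  qed
  obtain n0 where "M n0 \<le> M k" for k
    using ex_has_least_nat[of "\<lambda>_. True" _ M] by auto
  then have M_eq: "M n = M n0" if "n0 \<le> n" for n
    using decr[OF that] by (simp add: le_antisym)
  define m where "m = M n0"
  have "N (poly f t) = N (coeff (F n0) m) * N (t - s n) ^ m"
    if n: "n0 \<le> n" and t: "gap s n < N (t - s n)" "N (t - s n) \<le> gap s n0" for n t
  proof -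
    \<comment> \<open>Dominance on the outer disc excludes the exponents above m, dominance on the
      inner disc those below m.\<close>
    have dom: "dominant (F n) (gap s n0) m" "dominant (F n) (gap s n) m"
      using trans(1)[OF M n] M[of n] M_eq[OF n] by (simp_all add: m_def)
    have pos: "0 < gap s n"
      using pcs_gap_pos[OF s] .
    have "N (poly (F n) (t - s n)) = N (coeff (F n) m) * N (t - s n) ^ m"
    proof (rule N_poly_dominant)
      fix i
      assume "i \<noteq> m"
      then consider "i < m" | "m < i"
        by linarith
      then show "N (coeff (F n) i) * N (t - s n) ^ i < N (coeff (F n) m) * N (t - s n) ^ m"
        using dominant_lower_mono[OF dom(2) pos t(1)]
          dominant_upper_mono[OF dom(1) less_trans[OF pos t(1)] t(2)] by cases auto
    qed
    then show ?thesis
      using trans(2)[OF M n] by (simp add: F_def m_def poly_pcompose)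
  qed
  \<comment> \<open>This is the constant b; by \<open>trans\<close> the m-th coefficient has the
    same absolute value at every later centre.\<close>
  moreover have "0 < N (coeff (F n0) m)"
    using dominant_pos[OF M pcs_gap_pos[OF s]] by (simp add: m_def)
  ultimately show ?thesis
    by blast
qed

text \<open>Cancelling the smaller power of \<tau> leaves a condition that is monotone in \<tau>.
  Either its favourable outcome for small \<tau> occurs at some \<tau>1 > \<rho> and then persists
  below it, or the opposite outcome holds everywhere above \<rho>.\<close>

lemma monomial_le_eventually_constant:
  fixes a b \<rho> :: real
  assumes "0 \<le> \<rho>" "0 < a" "0 < b"
  shows "\<exists>\<tau>1>\<rho>. \<exists>B. \<forall>\<tau>. \<rho> < \<tau> \<longrightarrow> \<tau> \<le> \<tau>1 \<longrightarrow> (a * \<tau> ^ m \<le> b * \<tau> ^ k \<longleftrightarrow> B)"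
proof -
  have mono: "a * \<tau> ^ j \<le> a * \<tau>1 ^ j" if "0 < a" "\<rho> < \<tau>" "\<tau> \<le> \<tau>1" for a \<tau> \<tau>1 :: real and j
    using that assms(1) by (intro mult_left_mono power_mono) auto
  show ?thesis
  proof (cases "k \<le> m")
    case True
    have iff: "a * \<tau> ^ m \<le> b * \<tau> ^ k \<longleftrightarrow> a * \<tau> ^ (m - k) \<le> b" if "\<rho> < \<tau>" for \<tau>
    proof -
      have "\<tau> ^ m = \<tau> ^ (m - k) * \<tau> ^ k"
        using True by (simp flip: power_add)
      then show ?thesis
        using that assms(1) by simp
    qed
    show ?thesis
    proof (cases "\<exists>\<tau>1>\<rho>. a * \<tau>1 ^ (m - k) \<le> b")
      case True
      then obtain \<tau>1 where \<tau>1: "\<rho> < \<tau>1" "a * \<tau>1 ^ (m - k) \<le> b"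
        by blast
      have "a * \<tau> ^ m \<le> b * \<tau> ^ k" if "\<rho> < \<tau>" "\<tau> \<le> \<tau>1" for \<tau>
        using iff[OF that(1)] mono[OF assms(2) that, of "m - k"] \<tau>1(2) by linarith
      then show ?thesis
        using \<tau>1(1) by blast
    next
      case False
      then show ?thesis
        using iff by (intro exI[of _ "\<rho> + 1"] conjI exI[of _ False]) auto
    qed
  next
    case False
    have iff: "a * \<tau> ^ m \<le> b * \<tau> ^ k \<longleftrightarrow> a \<le> b * \<tau> ^ (k - m)" if "\<rho> < \<tau>" for \<tau>
    proof -
      have "\<tau> ^ k = \<tau> ^ (k - m) * \<tau> ^ m"
        using False by (simp flip: power_add)
      then show ?thesis
        using that assms(1) by simp
    qed
    show ?thesis
    proof (cases "\<exists>\<tau>1>\<rho>. \<not> a \<le> b * \<tau>1 ^ (k - m)")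
      case True
      then obtain \<tau>1 where \<tau>1: "\<rho> < \<tau>1" "\<not> a \<le> b * \<tau>1 ^ (k - m)"
        by blast
      have "\<not> a * \<tau> ^ m \<le> b * \<tau> ^ k" if "\<rho> < \<tau>" "\<tau> \<le> \<tau>1" for \<tau>
        using iff[OF that(1)] mono[OF assms(3) that, of "k - m"] \<tau>1(2) by linarith
      then show ?thesis
        using \<tau>1(1) by blast
    next
      case False
      then show ?thesis
        using iff by (intro exI[of _ "\<rho> + 1"] conjI exI[of _ True]) auto
    qed
  qed
qed

text \<open>Numerator and denominator both behave like monomials in \<open>N (t - s n)\<close>, so
  integrality of the value is a comparison of monomials. Its truth value B is the same for all n and
  t involved.\<close>

lemma pcs_ratfun_constant:
  assumes s: "pcs \<rho> s"
  shows "\<exists>n0 B. \<forall>n\<ge>n0. \<forall>t. gap s n < N (t - s n) \<longrightarrow> N (t - s n) \<le> gap s n0 \<longrightarrow>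
    ((\<exists>y\<in>{y. N y \<le> 1}. ratfun_value \<phi> t y) \<longleftrightarrow> B)"
proof -
  obtain p q where \<phi>: "\<phi> = Fract p q" and q: "q \<noteq> 0"
    by (cases \<phi>)
  show ?thesis
  proof (cases "p = 0")
    case True
    \<comment> \<open>The representation \<open>Fract 0 1\<close> is defined at every t, including
      the roots of q.\<close>
    then have "ratfun_value \<phi> t 0" for t
      unfolding ratfun_value_def \<phi> by (intro exI[of _ 0] exI[of _ 1]) (simp add: eq_fract q)
    then have "\<exists>y\<in>{y. N y \<le> 1}. ratfun_value \<phi> t y" for t
      by (intro bexI[of _ 0]) auto
    then show ?thesis
      by (intro exI[of _ 0] exI[of _ True]) simp
  next
    case False
    obtain n1 m b where 1: "0 < b" "\<And>n t. n \<ge> n1 \<Longrightarrow> gap s n < N (t - s n) \<Longrightarrow>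
        N (t - s n) \<le> gap s n1 \<Longrightarrow> N (poly p t) = b * N (t - s n) ^ m"
      using pcs_poly_monomial[OF s False] by blast
    obtain n2 k c where 2: "0 < c" "\<And>n t. n \<ge> n2 \<Longrightarrow> gap s n < N (t - s n) \<Longrightarrow>
        N (t - s n) \<le> gap s n2 \<Longrightarrow> N (poly q t) = c * N (t - s n) ^ k"
      using pcs_poly_monomial[OF s q] by blast
    obtain \<tau>1 B where 3: "\<rho> < \<tau>1"
      "\<And>\<tau>. \<rho> < \<tau> \<Longrightarrow> \<tau> \<le> \<tau>1 \<Longrightarrow> (b * \<tau> ^ m \<le> c * \<tau> ^ k \<longleftrightarrow> B)"
      using monomial_le_eventually_constant[OF pcs_nonneg[OF s] 1(1) 2(1), of m k] by blast
    obtain n3 where n3: "gap s n3 < \<tau>1"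
      using pcs_gap_below[OF s 3(1)] by blast
    define n0 where "n0 = max n1 (max n2 n3)"
    have const: "(\<exists>y\<in>{y. N y \<le> 1}. ratfun_value \<phi> t y) \<longleftrightarrow> B"
      if "n \<ge> n0" "gap s n < N (t - s n)" "N (t - s n) \<le> gap s n0" for n t
    proof -
      have le: "n1 \<le> n" "n2 \<le> n" "gap s n0 \<le> gap s n1" "gap s n0 \<le> gap s n2" "gap s n0 \<le> gap s n3"
        using that(1) pcs_gap_le[OF s] by (simp_all add: n0_def)
      define \<tau> where "\<tau> = N (t - s n)"
      have \<tau>: "\<rho> < \<tau>" "0 < \<tau>" "\<tau> \<le> \<tau>1"
        using that le n3 pcs_gap_gt[OF s, of n] pcs_gap_pos[OF s, of n] by (simp_all add: \<tau>_def)
      have val: "N (poly p t) = b * \<tau> ^ m" "N (poly q t) = c * \<tau> ^ k"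
        using 1(2)[of n t] 2(2)[of n t] that le by (simp_all add: \<tau>_def)
      \<comment> \<open>A positive constant times a power of a positive radius: t is no root of
        q.\<close>
      then have q0: "poly q t \<noteq> 0"
        using 2(1) \<tau> by (metis N_0 less_irrefl mult_pos_pos zero_less_power)
      then have "ratfun_value \<phi> t (poly p t / poly q t)"
        unfolding ratfun_value_def \<phi> by blast
      then have "(\<exists>y\<in>{y. N y \<le> 1}. ratfun_value \<phi> t y) \<longleftrightarrow> N (poly p t / poly q t) \<le> 1"
        using ratfun_value_unique by blast
      also have "\<dots> \<longleftrightarrow> N (poly p t) \<le> N (poly q t)"
        using N_pos[OF q0] by (simp add: N_divide[OF q0])
      finally show ?thesis
        using 3(2)[OF \<tau>(1,3)] by (simp add: val)
    qed
    show ?thesis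
      by (intro exI[of _ n0] exI[of _ B] allI impI const)
  qed
qed

text \<open>Two terms of t lying in all discs of index at least n0 would be at distance at most
  \<rho>, whereas distinct terms of t are more than \<rho> apart. So at most one term of t escapes
  every inner bound.\<close>

lemma pcs_eventually_in_annulus:
  assumes s: "pcs \<rho> s" and t: "pcs \<rho> t"
    and close: "\<forall>\<^sub>F k in sequentially. N (s k - t k) \<le> gap s n0"
  shows "\<forall>\<^sub>F k in sequentially. \<exists>n\<ge>n0. gap s n < N (t k - s n) \<and> N (t k - s n) \<le> gap s n0"
proof -
  have one_bad: "\<exists>n\<ge>n0. gap s n < N (t k - s n)"
    if bad: "\<forall>n\<ge>n0. N (t j - s n) \<le> gap s n" and "j < k" for j k
  proof (rule ccontr)
    assume "\<not> ?thesis"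
    then have "N (t k - s n) \<le> gap s n" if "n \<ge> n0" for n
      using that by (simp add: not_less)
    then have "N (t k - t j) \<le> gap s n" if "n \<ge> n0" for n
      using N_ultra[of "t k" "t j" "s n"] bad that N_minus_commute[of "s n" "t j"] by fastforce
    moreover have "gap s \<longlonglongrightarrow> \<rho>"
      using s by (simp add: pcs_def)
    ultimately have "N (t k - t j) \<le> \<rho>"
      by (intro LIMSEQ_le_const) auto
    then show False
      using pcs_dist[OF t \<open>j < k\<close>] pcs_gap_gt[OF t, of j] by simp
  qed
  have "\<forall>\<^sub>F k in sequentially. \<exists>n\<ge>n0. gap s n < N (t k - s n)"
  proof (cases "\<exists>j. \<forall>n\<ge>n0. N (t j - s n) \<le> gap s n")
    case True
    then obtain j where j: "\<forall>n\<ge>n0. N (t j - s n) \<le> gap s n" ..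
    show ?thesis
      using eventually_gt_at_top[of j] by (rule eventually_mono) (rule one_bad[OF j])
  next
    case False
    then show ?thesis
      by (auto simp: not_le)
  qed
  then show ?thesis
    using close eventually_ge_at_top[of n0]
  proof eventually_elim
    case (elim k)
    have "N (t k - s n) \<le> gap s n0" if "n \<ge> n0" for n
      using N_ultra[of "t k" "s n" "s k"] N_minus_commute[of "t k" "s k"] elim(2)
        pcs_dist_le[OF s that elim(3)] by simp
    then show ?case
      using elim(1) by blast
  qed
qed

text \<open>B is chosen before t. Hence t = s is a legitimate instance, and it identifies B with the
  behaviour of \<phi> along s.\<close>

lemma pcs_ratfun_locally_constant:
  assumes s: "pcs \<rho> s"
  shows "\<exists>n0 B. \<forall>t. pcs \<rho> t \<longrightarrow> (\<forall>\<^sub>F k in sequentially. N (s k - t k) \<le> gap s n0) \<longrightarrow>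
    (\<forall>\<^sub>F k in sequentially. (\<exists>y\<in>{y. N y \<le> 1}. ratfun_value \<phi> (t k) y) \<longleftrightarrow> B)"
proof -
  obtain n0 B where B: "\<forall>n\<ge>n0. \<forall>t. gap s n < N (t - s n) \<longrightarrow> N (t - s n) \<le> gap s n0 \<longrightarrow>
    ((\<exists>y\<in>{y. N y \<le> 1}. ratfun_value \<phi> t y) \<longleftrightarrow> B)"
    using pcs_ratfun_constant[OF s, of \<phi>] by (elim exE) (rule that)
  have const: "\<forall>\<^sub>F k in sequentially. (\<exists>y\<in>{y. N y \<le> 1}. ratfun_value \<phi> (t k) y) \<longleftrightarrow> B"
    if "pcs \<rho> t" "\<forall>\<^sub>F k in sequentially. N (s k - t k) \<le> gap s n0" for t
    using pcs_eventually_in_annulus[OF s that]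
  proof eventually_elim
    case (elim k)
    then show ?case
      using B by blast
  qed
  show ?thesis
    by (intro exI[of _ n0] exI[of _ B] allI impI const)
qed

text \<open>Once numerator and denominator are nonzero at \<open>s n\<close>, a value or its
  reciprocal is integral. Which alternative holds may still depend on n.\<close>

lemma eventually_ratfun_or_inverse:
  assumes s: "pcs \<rho> s" and "\<phi> \<noteq> 0"
  shows "\<forall>\<^sub>F n in sequentially. (\<exists>y\<in>{y. N y \<le> 1}. ratfun_value \<phi> (s n) y) \<or>
    (\<exists>y\<in>{y. N y \<le> 1}. ratfun_value (inverse \<phi>) (s n) y)"
proof -
  obtain p q where \<phi>: "\<phi> = Fract p q" and q: "q \<noteq> 0"
    by (cases \<phi>)
  have p: "p \<noteq> 0"
    using \<open>\<phi> \<noteq> 0\<close> \<phi> by (auto simp: fract_collapse)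
  from pcs_poly_nonzero[OF s p] pcs_poly_nonzero[OF s q] show ?thesis
  proof eventually_elim
    case (elim n)
    have "inverse \<phi> = Fract q p"
      by (simp add: \<phi>)
    then have "ratfun_value \<phi> (s n) (poly p (s n) / poly q (s n))"
      "ratfun_value (inverse \<phi>) (s n) (poly q (s n) / poly p (s n))"
      unfolding ratfun_value_def using \<phi> elim by blast+
    moreover have "N (poly p (s n) / poly q (s n)) \<le> 1 \<or> N (poly q (s n) / poly p (s n)) \<le> 1"
      using N_pos[OF elim(1)] N_pos[OF elim(2)] by (simp add: N_divide elim linear)
    ultimately show ?case
      by blast
  qed
qed

section \<open>The rings \<open>V_E\<close> as points of the Zariski space\<close>

lemma ratfun_value_const: "ratfun_value (to_fract [:c:]) x c"
  unfolding ratfun_value_def to_fract_def by (intro exI[of _ "[:c:]"] exI[of _ 1]) simp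

lemma ratfun_value_diff:
  assumes "ratfun_value \<phi> x y" "ratfun_value \<psi> x z"
  shows "ratfun_value (\<phi> - \<psi>) x (y - z)"
proof -
  obtain p q p' q' where *: "\<phi> = Fract p q" "poly q x \<noteq> 0" "y = poly p x / poly q x"
    "\<psi> = Fract p' q'" "poly q' x \<noteq> 0" "z = poly p' x / poly q' x"
    using assms unfolding ratfun_value_def by blast
  then have "q \<noteq> 0" "q' \<noteq> 0" by auto
  then show ?thesis
    unfolding ratfun_value_def using *
    by (intro exI[of _ "p * q' - p' * q"] exI[of _ "q * q'"]) (auto simp: diff_frac_eq)
qed

lemma ratfun_value_mult:
  assumes "ratfun_value \<phi> x y" "ratfun_value \<psi> x z"
  shows "ratfun_value (\<phi> * \<psi>) x (y * z)"
proof -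
  obtain p q p' q' where *: "\<phi> = Fract p q" "poly q x \<noteq> 0" "y = poly p x / poly q x"
    "\<psi> = Fract p' q'" "poly q' x \<noteq> 0" "z = poly p' x / poly q' x"
    using assms unfolding ratfun_value_def by blast
  then show ?thesis
    unfolding ratfun_value_def
    by (intro exI[of _ "p * p'"] exI[of _ "q * q'"]) simp
qed

text \<open>The ring axioms hold termwise. For the valuation axiom, local constancy with t = s makes
  one alternative of \<open>eventually_ratfun_or_inverse\<close> hold for all large indices.\<close>

lemma pc_ring_in_Zar:
  assumes s: "pcs \<rho> s"
  shows "pc_ring {x. N x \<le> 1} s \<in> Zar {x. N x \<le> 1}"
proof -
  let ?A = "{x. N x \<le> 1}"
  let ?W = "pc_ring ?A s"
  have const: "to_fract [:c:] \<in> ?W" if "c \<in> ?A" for c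
    unfolding pc_ring_def using that ratfun_value_const by (auto intro!: always_eventually)
  have diff: "\<phi> - \<psi> \<in> ?W" if "\<phi> \<in> ?W" "\<psi> \<in> ?W" for \<phi> \<psi>
    using that unfolding pc_ring_def mem_Collect_eq
  proof eventually_elim
    case (elim n)
    then obtain y z where "N y \<le> 1" "ratfun_value \<phi> (s n) y" "N z \<le> 1" "ratfun_value \<psi> (s n) z"
      by blast
    then show ?case
      using ratfun_value_diff N_diff[of y z] by (intro bexI[of _ "y - z"]) auto
  qed
  have mult: "\<phi> * \<psi> \<in> ?W" if "\<phi> \<in> ?W" "\<psi> \<in> ?W" for \<phi> \<psi>
    using that unfolding pc_ring_def mem_Collect_eq
  proof eventually_elim
    case (elim n)
    then obtain y z where "N y \<le> 1" "ratfun_value \<phi> (s n) y" "N z \<le> 1" "ratfun_value \<psi> (s n) z"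
      by blast
    then show ?case
      using ratfun_value_mult by (intro bexI[of _ "y * z"]) (auto simp: N_mult mult_le_one)
  qed
  have inv: "\<phi> \<in> ?W \<or> inverse \<phi> \<in> ?W" if "\<phi> \<noteq> 0" for \<phi>
  proof -
    obtain n0 B where *: "\<forall>t. pcs \<rho> t \<longrightarrow> (\<forall>\<^sub>F k in sequentially. N (s k - t k) \<le> gap s n0) \<longrightarrow>
        (\<forall>\<^sub>F k in sequentially. (\<exists>y\<in>?A. ratfun_value \<phi> (t k) y) \<longleftrightarrow> B)"
      using pcs_ratfun_locally_constant[OF s] by blast
    then have ev: "\<forall>\<^sub>F k in sequentially. (\<exists>y\<in>?A. ratfun_value \<phi> (s k) y) \<longleftrightarrow> B"
      using s by simp
    show ?thesis
    proof (cases B)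
      case True
      then show ?thesis
        using ev by (simp add: pc_ring_def)
    next
      case False
      have "\<forall>\<^sub>F k in sequentially. \<exists>y\<in>?A. ratfun_value (inverse \<phi>) (s k) y"
        using ev eventually_ratfun_or_inverse[OF s that] by eventually_elim (use False in blast)
      then show ?thesis
        by (simp add: pc_ring_def)
    qed
  qed
  have "0 \<in> ?W" "1 \<in> ?W"
    using const[of 0] const[of 1] by (simp_all flip: one_pCons)
  then show ?thesis
    using const diff mult inv by (auto simp: Zar_def valuation_domain_def)
qed

lemma pc_ring_locally_constant:
  assumes s: "pcs \<rho> s"
  shows "\<exists>n0. \<forall>t. pcs \<rho> t \<longrightarrow> (\<forall>\<^sub>F k in sequentially. N (s k - t k) \<le> gap s n0) \<longrightarrow>
    (\<phi> \<in> pc_ring {x. N x \<le> 1} t \<longleftrightarrow> \<phi> \<in> pc_ring {x. N x \<le> 1} s)"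
proof -
  obtain n0 B where *: "\<forall>t. pcs \<rho> t \<longrightarrow> (\<forall>\<^sub>F k in sequentially. N (s k - t k) \<le> gap s n0) \<longrightarrow>
    (\<forall>\<^sub>F k in sequentially. (\<exists>y\<in>{y. N y \<le> 1}. ratfun_value \<phi> (t k) y) \<longleftrightarrow> B)"
    using pcs_ratfun_locally_constant[OF s] by blast
  have "\<phi> \<in> pc_ring {x. N x \<le> 1} t \<longleftrightarrow> B"
    if "pcs \<rho> t" "\<forall>\<^sub>F k in sequentially. N (s k - t k) \<le> gap s n0" for t
  proof -
    have "(\<forall>\<^sub>F k in sequentially. \<exists>y\<in>{y. N y \<le> 1}. ratfun_value \<phi> (t k) y)
        \<longleftrightarrow> (\<forall>\<^sub>F k::nat in sequentially. B)"
      using * that by (intro eventually_subst) blast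
    then show ?thesis
      by (simp add: pc_ring_def)
  qed
  moreover have "\<forall>\<^sub>F k in sequentially. N (s k - s k) \<le> gap s n0"
    by simp
  ultimately show ?thesis
    using s by blast
qed

text \<open>(X - a) / c tests whether a sequence finally stays in the closed disc around a of radius
  \<open>N c\<close>.\<close>

lemma linear_mem_pc_ring_iff:
  assumes "c \<noteq> 0"
  shows "Fract [:- a, 1:] [:c:] \<in> pc_ring {x. N x \<le> 1} t
    \<longleftrightarrow> (\<forall>\<^sub>F k in sequentially. N (t k - a) \<le> N c)"
proof -
  have val: "ratfun_value (Fract [:- a, 1:] [:c:]) x ((x - a) / c)" for x
    unfolding ratfun_value_def
    by (intro exI[of _ "[:- a, 1:]"] exI[of _ "[:c:]"]) (use assms in simp)
  have "(\<exists>y\<in>{x. N x \<le> 1}. ratfun_value (Fract [:- a, 1:] [:c:]) x y) \<longleftrightarrow> N (x - a) \<le> N c" for x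
  proof -
    have "(\<exists>y\<in>{x. N x \<le> 1}. ratfun_value (Fract [:- a, 1:] [:c:]) x y) \<longleftrightarrow> N ((x - a) / c) \<le> 1"
      using val ratfun_value_unique by blast
    then show ?thesis
      using N_pos[OF assms] by (simp add: N_divide[OF assms])
  qed
  then show ?thesis
    by (simp add: pc_ring_def)
qed


section \<open>The distance of two pseudo-convergent sequences\<close>

text \<open>The sequence whose limit is the distance d_\<delta>, with \<rho> in place of
  \<open>exp_minus \<delta>\<close>.\<close>

abbreviation excess :: "real \<Rightarrow> (nat \<Rightarrow> 'a) \<Rightarrow> (nat \<Rightarrow> 'a) \<Rightarrow> nat \<Rightarrow> real" where
  "excess \<rho> s t \<equiv> \<lambda>n. max (N (s n - t n) - \<rho>) 0"

lemma excess_commute: "excess \<rho> s t = excess \<rho> t s"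
  using N_minus_commute by metis

lemma excess_triangle: "excess \<rho> s u n \<le> excess \<rho> s t n + excess \<rho> t u n"
  using N_ultra[of "s n" "u n" "t n"] by (auto simp: max_def split: if_splits)

text \<open>From index n on, \<open>s k\<close> lies in the disc around \<open>s n\<close>, so it
  serves as a centre equally well. This links membership in the ring with the distance of the
  sequences.\<close>

lemma disc_mem_pc_ring_iff:
  assumes s: "pcs \<rho> s"
  shows "Fract [:- s n, 1:] [:s (Suc n) - s n:] \<in> pc_ring {x. N x \<le> 1} t
    \<longleftrightarrow> (\<forall>\<^sub>F k in sequentially. N (s k - t k) \<le> gap s n)"
proof -
  have "s (Suc n) - s n \<noteq> 0"
    using pcs_gap_pos[OF s, of n] by auto
  then have "Fract [:- s n, 1:] [:s (Suc n) - s n:] \<in> pc_ring {x. N x \<le> 1} t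
      \<longleftrightarrow> (\<forall>\<^sub>F k in sequentially. N (t k - s n) \<le> gap s n)"
    by (rule linear_mem_pc_ring_iff)
  also have "\<dots> \<longleftrightarrow> (\<forall>\<^sub>F k in sequentially. N (s k - t k) \<le> gap s n)"
  proof (intro eventually_subst eventually_mono[OF eventually_ge_at_top[of n]])
    fix k
    assume "n \<le> k"
    then have "N (s k - s n) \<le> gap s n"
      using pcs_dist_le[OF s] by blast
    then show "N (t k - s n) \<le> gap s n \<longleftrightarrow> N (s k - t k) \<le> gap s n"
      using N_ultra[of "t k" "s n" "s k"] N_ultra[of "s k" "t k" "s n"]
        N_minus_commute[of "t k" "s k"] N_minus_commute[of "t k" "s n"] by auto
  qed
  finally show ?thesis .
qed

lemma excess_tendsto_less:
  assumes "excess \<rho> s t \<longlonglongrightarrow> l" "l < gap s n - \<rho>"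
  shows "\<forall>\<^sub>F k in sequentially. N (s k - t k) \<le> gap s n"
  using order_tendstoD(2)[OF assms] by eventually_elim auto

lemma excess_tendsto_le:
  assumes "excess \<rho> s t \<longlonglongrightarrow> l" "pcs \<rho> s" "\<forall>\<^sub>F k in sequentially. N (s k - t k) \<le> gap s n"
  shows "l \<le> gap s n - \<rho>"
proof (rule tendsto_upperbound[OF assms(1)])
  show "\<forall>\<^sub>F k in sequentially. excess \<rho> s t k \<le> gap s n - \<rho>"
    using assms(3)
  proof eventually_elim
    case (elim k)
    then show ?case
      using pcs_gap_gt[OF assms(2), of n] by simp
  qed
qed simp

text \<open>Every disc function built from s lies in the ring of s, hence in that of t; thus t
  finally enters discs of radius arbitrarily close to \<rho>.\<close>

lemma excess_tendsto_0:
  assumes s: "pcs \<rho> s" and eq: "pc_ring {x. N x \<le> 1} s = pc_ring {x. N x \<le> 1} t"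
  shows "excess \<rho> s t \<longlonglongrightarrow> 0"
proof (rule order_tendstoI)
  fix e :: real
  assume "0 < e"
  then obtain n where n: "gap s n < \<rho> + e"
    using pcs_gap_below[OF s, of "\<rho> + e"] by auto
  have "\<forall>\<^sub>F k in sequentially. N (s k - s k) \<le> gap s n"
    by simp
  then have "\<forall>\<^sub>F k in sequentially. N (s k - t k) \<le> gap s n"
    unfolding disc_mem_pc_ring_iff[OF s, symmetric] eq .
  then show "\<forall>\<^sub>F k in sequentially. excess \<rho> s t k < e"
  proof eventually_elim
    case (elim k)
    then show ?case
      using n \<open>0 < e\<close> by simp
  qed
qed (auto intro: always_eventually)

text \<open>Either some distance exceeds the size of both tails and is then frozen, or the distances
  are bounded by the gaps, which tend to \<rho>.\<close>

lemma excess_convergent: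
  assumes s: "pcs \<rho> s" and t: "pcs \<rho> t"
  shows "convergent (excess \<rho> s t)"
proof (cases "\<exists>n0 k. n0 \<le> k \<and> max (gap s n0) (gap t n0) < N (s k - t k)")
  case True
  then obtain n0 k where k: "n0 \<le> k" "max (gap s n0) (gap t n0) < N (s k - t k)"
    by blast
  have "N (s j - t j) = N (s k - t k)" if "n0 \<le> j" for j
  proof -
    \<comment> \<open>Both tails move by less than the distance already reached, so the isosceles
      principle preserves it.\<close>
    have "N ((s j - s k) - (t j - t k)) < N (s k - t k)"
      using N_diff[of "s j - s k" "t j - t k"] pcs_dist_le[OF s k(1) that]
        pcs_dist_le[OF t k(1) that] k(2) by auto
    from N_add_eq[OF this] show ?thesis
      by (simp add: algebra_simps)
  qed
  then have "\<forall>\<^sub>F j in sequentially. excess \<rho> s t j = max (N (s k - t k) - \<rho>) 0"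
    by (intro eventually_mono[OF eventually_ge_at_top[of n0]]) simp
  then have "excess \<rho> s t \<longlonglongrightarrow> max (N (s k - t k) - \<rho>) 0"
    by (rule tendsto_eventually)
  then show ?thesis
    by (rule convergentI)
next
  case False
  have "excess \<rho> s t \<longlonglongrightarrow> 0"
  proof (rule tendsto_sandwich[where f = "\<lambda>_. 0"])
    show "\<forall>\<^sub>F k in sequentially. excess \<rho> s t k \<le> max (gap s k - \<rho>) (gap t k - \<rho>)"
    proof (intro always_eventually allI)
      fix k
      have "N (s k - t k) \<le> max (gap s k) (gap t k)"
        using False by (meson leI order_refl)
      then show "excess \<rho> s t k \<le> max (gap s k - \<rho>) (gap t k - \<rho>)"
        using pcs_gap_gt[OF s, of k] by auto
    qed
    have "(\<lambda>k. max (gap s k - \<rho>) (gap t k - \<rho>)) \<longlonglongrightarrow> max (\<rho> - \<rho>) (\<rho> - \<rho>)"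
      using s t unfolding pcs_def by (intro tendsto_intros) auto
    then show "(\<lambda>k. max (gap s k - \<rho>) (gap t k - \<rho>)) \<longlonglongrightarrow> 0"
      by simp
  qed (auto intro: always_eventually)
  then show ?thesis
    unfolding convergent_def by blast
qed

text \<open>Well-definedness of d_\<delta>: by the quadrilateral inequality, changing
  representatives alters the excess by a null sequence.\<close>

lemma excess_tendsto_cong:
  assumes "pcs \<rho> s" "pcs \<rho> t"
    and "pc_ring {x. N x \<le> 1} s = pc_ring {x. N x \<le> 1} s'"
    and "pc_ring {x. N x \<le> 1} t = pc_ring {x. N x \<le> 1} t'"
    and "excess \<rho> s t \<longlonglongrightarrow> l"
  shows "excess \<rho> s' t' \<longlonglongrightarrow> l"
proof -
  have 0: "(\<lambda>n. excess \<rho> s s' n + excess \<rho> t t' n) \<longlonglongrightarrow> 0"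
    using tendsto_add[OF excess_tendsto_0[OF assms(1,3)] excess_tendsto_0[OF assms(2,4)]] by simp
  have "\<bar>excess \<rho> s' t' n - excess \<rho> s t n\<bar> \<le> excess \<rho> s s' n + excess \<rho> t t' n" for n
  proof -
    define D where "D a b = excess \<rho> a b n" for a b
    have "D a c \<le> D a b + D b c" for a b c
      unfolding D_def by (rule excess_triangle)
    then have "D s' t' \<le> D s' s + D s t'" "D s t' \<le> D s t + D t t'"
      "D s t \<le> D s s' + D s' t" "D s' t \<le> D s' t' + D t' t"
      by blast+
    moreover have "D s' s = D s s'" "D t' t = D t t'"
      unfolding D_def by (simp_all add: N_minus_commute)
    ultimately have "\<bar>D s' t' - D s t\<bar> \<le> D s s' + D t t'"
      by linarith
    then show ?thesis
      by (simp only: D_def)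
  qed
  then have "(\<lambda>n. excess \<rho> s' t' n - excess \<rho> s t n) \<longlonglongrightarrow> 0"
    by (intro Lim_null_comparison[OF _ 0]) (auto intro!: always_eventually)
  from tendsto_add[OF this assms(5)] show ?thesis
    by simp
qed

end


section \<open>The space of rings of fixed breadth\<close>

text \<open>The value -\<infinity> is excluded because \<open>real_of_ereal\<close> sends it to 0,
  which would give \<open>exp_minus\<close> the value 1 there.\<close>

lemma exp_minus_le_iff:
  assumes "a \<noteq> -\<infinity>" "b \<noteq> -\<infinity>"
  shows "exp_minus a \<le> exp_minus b \<longleftrightarrow> b \<le> a"
  using assms by (cases a; cases b) (auto simp: exp_minus_def not_le)

lemma exp_minus_less_iff:
  assumes "a \<noteq> -\<infinity>" "b \<noteq> -\<infinity>"
  shows "exp_minus a < exp_minus b \<longleftrightarrow> b < a"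
  using exp_minus_le_iff[OF assms(2,1)] by (simp flip: not_le)

lemma tendsto_exp_minus:
  assumes lim: "a \<longlonglongrightarrow> \<delta>" and "\<delta> \<noteq> -\<infinity>" and fin: "\<And>n::nat. \<bar>a n\<bar> \<noteq> \<infinity>"
  shows "(\<lambda>n. exp_minus (a n)) \<longlonglongrightarrow> exp_minus \<delta>"
proof -
  define b where "b n = real_of_ereal (a n)" for n
  have a: "a = (\<lambda>n. ereal (b n))"
    using fin by (simp add: b_def ereal_real')
  have exp: "exp_minus (a n) = exp (- b n)" for n
    by (simp add: a exp_minus_def)
  show ?thesis
  proof (cases \<delta>)
    case (real d)
    then have "b \<longlonglongrightarrow> d"
      using lim by (simp add: a)
    then show ?thesis
      unfolding exp using real by (auto simp: exp_minus_def intro!: tendsto_intros)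
  next
    case PInf
    then have "filterlim b at_top sequentially"
      using lim by (simp add: a tendsto_PInfty_eq_at_top)
    then have "filterlim (\<lambda>n. - b n) at_bot sequentially"
      by (simp add: filterlim_uminus_at_bot)
    from filterlim_compose[OF exp_at_bot this] show ?thesis
      unfolding exp using PInf by (simp add: exp_minus_def)
  qed (use assms in simp)
qed

locale breadth_space =
  fixes V :: "'a::field set" and v :: "'a \<Rightarrow> ereal" and \<delta> :: ereal
  assumes assoc: "associated_valuation V v" and not_MInf: "\<delta> \<noteq> -\<infinity>"
begin

lemma v_not_MInf: "v x \<noteq> -\<infinity>"
  using assoc by (cases "x = 0") (force simp: associated_valuation_def)+

sublocale nonarch_abs "\<lambda>x. exp_minus (v x)"
proof
  show "exp_minus (v 0) = 0"
    using assoc by (simp add: associated_valuation_def exp_minus_def)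
  show "0 < exp_minus (v x)" if "x \<noteq> 0" for x
    using assoc that by (auto simp: associated_valuation_def exp_minus_def)
  show "exp_minus (v (x * y)) = exp_minus (v x) * exp_minus (v y)" for x y
  proof -
    have "v (x * y) = v x + v y"
      using assoc by (simp add: associated_valuation_def)
    then show ?thesis
      using v_not_MInf[of x] v_not_MInf[of y]
      by (cases "v x"; cases "v y") (auto simp: exp_minus_def exp_add[symmetric])
  qed
  show "exp_minus (v (x + y)) \<le> max (exp_minus (v x)) (exp_minus (v y))" for x y
  proof -
    have "min (v x) (v y) \<le> v (x + y)"
      using assoc by (simp add: associated_valuation_def)
    then show ?thesis
      by (simp add: le_max_iff_disj exp_minus_le_iff v_not_MInf min_le_iff_disj)
  qed
qed

lemma V_eq: "V = {x. exp_minus (v x) \<le> 1}"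
proof -
  have "exp_minus (v x) \<le> exp_minus 0 \<longleftrightarrow> 0 \<le> v x" for x
    using exp_minus_le_iff[OF v_not_MInf, of 0 x] by simp
  then show ?thesis
    using assoc by (simp add: associated_valuation_def exp_minus_def)
qed

section \<open>Sequences of breadth \<delta> and the metric they define\<close>

definition seqs :: "(nat \<Rightarrow> 'a) set" where
  "seqs = {s. pseudo_convergent v s \<and> breadth v s = \<delta>}"

lemma pc_rings_eq: "pc_rings V v \<delta> = pc_ring V ` seqs"
  by (auto simp: pc_rings_def seqs_def)

lemma seqs_pcs:
  assumes "s \<in> seqs"
  shows "pcs (exp_minus \<delta>) s"
proof -
  define a where "a n = v (s (Suc n) - s n)" for n
  have less: "a n < a (Suc n)" for n
    using assms by (simp add: seqs_def pseudo_convergent_def a_def)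
  then have "incseq a"
    by (intro incseq_SucI less_imp_le)
  \<comment> \<open>\<open>breadth\<close> is defined by \<open>lim\<close>, which is meaningful
    here since an increasing sequence of extended reals converges to its supremum.\<close>
  from LIMSEQ_SUP[OF this] have "a \<longlonglongrightarrow> lim a"
    using limI by metis
  then have "a \<longlonglongrightarrow> \<delta>"
    using assms by (simp add: seqs_def breadth_def flip: a_def)
  \<comment> \<open>A term equal to \<infinity> could not be strictly below its successor.\<close>
  moreover have "\<bar>a n\<bar> \<noteq> \<infinity>" for n
    using less[of n] v_not_MInf[of "s (Suc n) - s n"] by (auto simp: a_def)
  ultimately have "(\<lambda>n. exp_minus (a n)) \<longlonglongrightarrow> exp_minus \<delta>"
    using not_MInf by (intro tendsto_exp_minus)
  moreover have "exp_minus (a (Suc n)) < exp_minus (a n)" for n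
    using less[of n] by (simp add: exp_minus_less_iff a_def v_not_MInf)
  ultimately show ?thesis
    by (simp add: pcs_def a_def)
qed

text \<open>Resolves the definite description: a limit exists, it is shared by all representatives,
  and the pair s, t itself forces uniqueness.\<close>

lemma pc_dist_tendsto:
  assumes "s \<in> seqs" "t \<in> seqs"
  shows "excess (exp_minus \<delta>) s t \<longlonglongrightarrow> pc_dist V v \<delta> (pc_ring V s) (pc_ring V t)"
proof -
  obtain l where l: "excess (exp_minus \<delta>) s t \<longlonglongrightarrow> l"
    using excess_convergent[OF assms[THEN seqs_pcs]] by (auto simp: convergent_def)
  have "(THE r. \<forall>s' t'.
      pseudo_convergent v s' \<and> breadth v s' = \<delta> \<and> pc_ring V s = pc_ring V s' \<and>
      pseudo_convergent v t' \<and> breadth v t' = \<delta> \<and> pc_ring V t = pc_ring V t' \<longrightarrow>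
      (\<lambda>n. max (val_dist v (s' n) (t' n) - exp_minus \<delta>) 0) \<longlonglongrightarrow> r) = l"
  proof (rule the_equality)
    show "\<forall>s' t'.
      pseudo_convergent v s' \<and> breadth v s' = \<delta> \<and> pc_ring V s = pc_ring V s' \<and>
      pseudo_convergent v t' \<and> breadth v t' = \<delta> \<and> pc_ring V t = pc_ring V t' \<longrightarrow>
      (\<lambda>n. max (val_dist v (s' n) (t' n) - exp_minus \<delta>) 0) \<longlonglongrightarrow> l"
      unfolding val_dist_def
      using excess_tendsto_cong[OF assms[THEN seqs_pcs] _ _ l, folded V_eq] by blast
  next
    fix r
    assume "\<forall>s' t'.
      pseudo_convergent v s' \<and> breadth v s' = \<delta> \<and> pc_ring V s = pc_ring V s' \<and>
      pseudo_convergent v t' \<and> breadth v t' = \<delta> \<and> pc_ring V t = pc_ring V t' \<longrightarrow>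
      (\<lambda>n. max (val_dist v (s' n) (t' n) - exp_minus \<delta>) 0) \<longlonglongrightarrow> r"
    then have "excess (exp_minus \<delta>) s t \<longlonglongrightarrow> r"
      using assms by (simp add: seqs_def val_dist_def)
    then show "r = l"
      using l LIMSEQ_unique by blast
  qed
  then have "pc_dist V v \<delta> (pc_ring V s) (pc_ring V t) = l"
    using assms by (simp add: pc_dist_def pc_rings_eq)
  then show ?thesis
    using l by simp
qed

lemma mem_pc_ring_locally_constant:
  assumes "s \<in> seqs"
  shows "\<exists>r>0. \<forall>t\<in>seqs. pc_dist V v \<delta> (pc_ring V s) (pc_ring V t) < r \<longrightarrow>
    (\<phi> \<in> pc_ring V t \<longleftrightarrow> \<phi> \<in> pc_ring V s)"
proof -
  note s = seqs_pcs[OF assms]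
  obtain n where n: "\<And>t. pcs (exp_minus \<delta>) t \<Longrightarrow>
      \<forall>\<^sub>F k in sequentially. exp_minus (v (s k - t k)) \<le> gap s n \<Longrightarrow>
      \<phi> \<in> pc_ring V t \<longleftrightarrow> \<phi> \<in> pc_ring V s"
    using pc_ring_locally_constant[OF s, folded V_eq] by blast
  \<comment> \<open>The radius is what the n-th disc exceeds the limiting one by; a smaller distance
    forces t finally to stay within \<open>gap s n\<close> of s.\<close>
  have "0 < gap s n - exp_minus \<delta>"
    using pcs_gap_gt[OF s] by simp
  moreover have "\<phi> \<in> pc_ring V t \<longleftrightarrow> \<phi> \<in> pc_ring V s"
    if "t \<in> seqs" "pc_dist V v \<delta> (pc_ring V s) (pc_ring V t) < gap s n - exp_minus \<delta>" for t
    using n[OF seqs_pcs excess_tendsto_less[OF pc_dist_tendsto]] assms that by simp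
  ultimately show ?thesis
    by blast
qed

sublocale Metric_space "pc_rings V v \<delta>" "pc_dist V v \<delta>"
proof
  have "0 \<le> pc_dist V v \<delta> (pc_ring V s) (pc_ring V t)" if "s \<in> seqs" "t \<in> seqs" for s t
    by (rule LIMSEQ_le_const[OF pc_dist_tendsto[OF that]]) simp
  then show "0 \<le> pc_dist V v \<delta> W W'" for W W'
    by (cases "W \<in> pc_rings V v \<delta> \<and> W' \<in> pc_rings V v \<delta>") (auto simp: pc_rings_eq pc_dist_def)
  have "pc_dist V v \<delta> (pc_ring V s) (pc_ring V t) = pc_dist V v \<delta> (pc_ring V t) (pc_ring V s)"
    if "s \<in> seqs" "t \<in> seqs" for s t
    by (rule LIMSEQ_unique[OF pc_dist_tendsto[OF that]])
      (subst excess_commute[where s = s and t = t], rule pc_dist_tendsto[OF that(2,1)])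
  then show "pc_dist V v \<delta> W W' = pc_dist V v \<delta> W' W" for W W'
    by (cases "W \<in> pc_rings V v \<delta> \<and> W' \<in> pc_rings V v \<delta>") (auto simp: pc_rings_eq pc_dist_def)
  show "pc_dist V v \<delta> W W' = 0 \<longleftrightarrow> W = W'"
    if "W \<in> pc_rings V v \<delta>" "W' \<in> pc_rings V v \<delta>" for W W'
  proof -
    obtain s t where st: "s \<in> seqs" "t \<in> seqs" "W = pc_ring V s" "W' = pc_ring V t"
      using \<open>W \<in> _\<close> \<open>W' \<in> _\<close> by (auto simp: pc_rings_eq)
    show ?thesis
    proof
      \<comment> \<open>Distance 0 is below every radius supplied by
        \<open>mem_pc_ring_locally_constant\<close>.\<close>
      assume "pc_dist V v \<delta> W W' = 0"
      then have "\<phi> \<in> W \<longleftrightarrow> \<phi> \<in> W'" for \<phi>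
        using mem_pc_ring_locally_constant[OF st(1), of \<phi>] st by force
      then show "W = W'"
        by blast
    next
      assume "W = W'"
      then have "excess (exp_minus \<delta>) s t \<longlonglongrightarrow> 0"
        using excess_tendsto_0[OF seqs_pcs[OF st(1)], folded V_eq] st by simp
      then show "pc_dist V v \<delta> W W' = 0"
        using LIMSEQ_unique[OF pc_dist_tendsto[OF st(1,2)]] st by simp
    qed
  qed
  show "pc_dist V v \<delta> W1 W3 \<le> pc_dist V v \<delta> W1 W2 + pc_dist V v \<delta> W2 W3"
    if W: "W1 \<in> pc_rings V v \<delta>" "W2 \<in> pc_rings V v \<delta>" "W3 \<in> pc_rings V v \<delta>" for W1 W2 W3
  proof -
    obtain s t u where st: "s \<in> seqs" "t \<in> seqs" "u \<in> seqs"
      "W1 = pc_ring V s" "W2 = pc_ring V t" "W3 = pc_ring V u"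
      using W by (auto simp: pc_rings_eq)
    show ?thesis
      unfolding st
      by (rule LIMSEQ_le[OF pc_dist_tendsto[OF st(1,3)]
            tendsto_add[OF pc_dist_tendsto[OF st(1,2)] pc_dist_tendsto[OF st(2,3)]]])
        (use excess_triangle in blast)
  qed
qed

lemma pc_rings_subset_Zar: "pc_rings V v \<delta> \<subseteq> Zar V"
  using pc_ring_in_Zar[OF seqs_pcs, folded V_eq] by (auto simp: pc_rings_eq)

section \<open>Comparison of the three topologies\<close>

lemma openin_mem: "openin mtopology {W \<in> pc_rings V v \<delta>. \<phi> \<in> W}"
  and openin_not_mem: "openin mtopology {W \<in> pc_rings V v \<delta>. \<phi> \<notin> W}"
proof -
  have *: "\<exists>r>0. \<forall>W'\<in>mball W r. \<phi> \<in> W' \<longleftrightarrow> \<phi> \<in> W" if "W \<in> pc_rings V v \<delta>" for W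
  proof -
    obtain s where s: "s \<in> seqs" "W = pc_ring V s"
      using \<open>W \<in> _\<close> by (auto simp: pc_rings_eq)
    then obtain r where r: "r > 0" "\<And>t. t \<in> seqs \<Longrightarrow> pc_dist V v \<delta> W (pc_ring V t) < r \<Longrightarrow>
        (\<phi> \<in> pc_ring V t \<longleftrightarrow> \<phi> \<in> W)"
      using mem_pc_ring_locally_constant[OF s(1), of \<phi>] by blast
    have "\<phi> \<in> W' \<longleftrightarrow> \<phi> \<in> W" if W': "W' \<in> mball W r" for W'
    proof -
      have "W' \<in> pc_ring V ` seqs" "pc_dist V v \<delta> W W' < r"
        using W' unfolding pc_rings_eq[symmetric] by simp_all
      then show ?thesis
        using r(2) by blast
    qed
    then show ?thesis
      using r(1) by blast
  qed
  \<comment> \<open>Membership of \<phi> is locally constant, so any condition P on its truth value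
    is open; the identity and \<open>Not\<close> give the two claims.\<close>
  have "openin mtopology {W \<in> pc_rings V v \<delta>. P (\<phi> \<in> W)}" for P
    unfolding openin_mtopology
  proof (intro conjI allI impI)
    fix W
    assume W: "W \<in> {W \<in> pc_rings V v \<delta>. P (\<phi> \<in> W)}"
    then have "W \<in> pc_rings V v \<delta>"
      by simp
    from *[OF this] obtain r
      where r: "r > 0" "\<forall>W'\<in>mball W r. \<phi> \<in> W' \<longleftrightarrow> \<phi> \<in> W"
      by (elim exE conjE) (rule that)
    have "mball W r \<subseteq> {W \<in> pc_rings V v \<delta>. P (\<phi> \<in> W)}"
    proof
      fix W'
      assume W': "W' \<in> mball W r"
      have "(\<phi> \<in> W') = (\<phi> \<in> W)"
        using bspec[OF r(2) W'] .
      moreover have "W' \<in> pc_rings V v \<delta>"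
        using W' by simp
      ultimately show "W' \<in> {W \<in> pc_rings V v \<delta>. P (\<phi> \<in> W)}"
        using W by simp
    qed
    then show "\<exists>r>0. mball W r \<subseteq> {W \<in> pc_rings V v \<delta>. P (\<phi> \<in> W)}"
      using r(1) by blast
  qed simp
  from this[of "\<lambda>b. b"] this[of Not]
  show "openin mtopology {W \<in> pc_rings V v \<delta>. \<phi> \<in> W}"
    "openin mtopology {W \<in> pc_rings V v \<delta>. \<phi> \<notin> W}"
    by simp_all
qed

text \<open>Continuity of the identity map reduces the claim to generators. Their traces are finite
  intersections of the sets \<phi> \<in> W, or unions of the sets \<phi> \<notin> W.\<close>

lemma openin_constructible_imp_metric:
  assumes "openin (constructible_topology V) U"
  shows "openin mtopology (U \<inter> pc_rings V v \<delta>)"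
proof -
  have pos: "openin mtopology (B \<inter> pc_rings V v \<delta>)"
    and neg: "openin mtopology ((Zar V - B) \<inter> pc_rings V v \<delta>)"
    if B: "B \<in> Zar_basic_inters V" for B
  proof -
    obtain F where F: "finite F" "F \<noteq> {}" "B = (\<Inter>\<phi>\<in>F. Zar_basic V \<phi>)"
      using B by (auto simp: Zar_basic_inters_def)
    have "B \<inter> pc_rings V v \<delta> = (\<Inter>\<phi>\<in>F. {W \<in> pc_rings V v \<delta>. \<phi> \<in> W})"
      using F(2) pc_rings_subset_Zar by (auto simp: F(3) Zar_basic_def)
    also have "openin mtopology \<dots>"
      using F openin_mem by (intro openin_Inter) auto
    finally show "openin mtopology (B \<inter> pc_rings V v \<delta>)" .
    have "(Zar V - B) \<inter> pc_rings V v \<delta> = (\<Union>\<phi>\<in>F. {W \<in> pc_rings V v \<delta>. \<phi> \<notin> W})"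
      using pc_rings_subset_Zar by (auto simp: F(3) Zar_basic_def)
    also have "openin mtopology \<dots>"
      using openin_not_mem by (intro openin_Union) auto
    finally show "openin mtopology ((Zar V - B) \<inter> pc_rings V v \<delta>)" .
  qed
  have "continuous_map mtopology (constructible_topology V) id"
    unfolding constructible_topology_def
  proof (rule continuous_on_generated_topo)
    show "openin mtopology (id -` G \<inter> topspace mtopology)"
      if "G \<in> Zar_basic_inters V \<union> (\<lambda>B. Zar V - B) ` Zar_basic_inters V" for G
      using that pos neg by auto
    show "id ` topspace mtopology
        \<subseteq> \<Union> (Zar_basic_inters V \<union> (\<lambda>B. Zar V - B) ` Zar_basic_inters V)"
      using pc_rings_subset_Zar Zar_in_basic_inters[of V] by auto
  qed
  from openin_continuous_map_preimage[OF this assms] show ?thesis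
    by (simp add: Int_def conj_commute)
qed

lemma openin_metric_imp_zariski:
  assumes "openin mtopology U"
  shows "openin (subtopology (zariski_topology V) (pc_rings V v \<delta>)) U"
  unfolding openin_subopen[of _ U]
proof
  fix W
  assume "W \<in> U"
  then obtain r where r: "0 < r" "mball W r \<subseteq> U" and W: "W \<in> pc_rings V v \<delta>"
    using assms unfolding openin_mtopology by blast
  from W obtain s where s: "s \<in> seqs" "W = pc_ring V s"
    by (auto simp: pc_rings_eq)
  note pcs = seqs_pcs[OF s(1)]
  \<comment> \<open>Membership of the n-th disc function bounds the distance by
    \<open>gap s n - exp_minus \<delta>\<close>; this choice of n puts the bound below r.\<close>
  obtain n where n: "gap s n < exp_minus \<delta> + r"
    using pcs_gap_below[OF pcs, of "exp_minus \<delta> + r"] r(1) by auto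
  define \<phi> where "\<phi> = Fract [:- s n, 1:] [:s (Suc n) - s n:]"
  have \<phi>: "\<phi> \<in> pc_ring V t \<longleftrightarrow> (\<forall>\<^sub>F k in sequentially. exp_minus (v (s k - t k)) \<le> gap s n)" for t
    using disc_mem_pc_ring_iff[OF pcs, folded V_eq] by (simp add: \<phi>_def)
  have ball: "W' \<in> mball W r" if W': "W' \<in> pc_rings V v \<delta>" "\<phi> \<in> W'" for W'
  proof -
    obtain t where t: "t \<in> seqs" "W' = pc_ring V t"
      using W' by (auto simp: pc_rings_eq)
    have "pc_dist V v \<delta> W W' \<le> gap s n - exp_minus \<delta>"
      using excess_tendsto_le[OF pc_dist_tendsto[OF s(1) t(1)] pcs] \<phi> W' s t by simp
    then show ?thesis
      using n W' W by (simp add: mball_def)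
  qed
  have "openin (zariski_topology V) (Zar_basic V \<phi>)"
    unfolding zariski_topology_def by (intro topology_generated_by_Basis) simp
  then have "openin (subtopology (zariski_topology V) (pc_rings V v \<delta>))
      (Zar_basic V \<phi> \<inter> pc_rings V v \<delta>)"
    by (auto simp: openin_subtopology)
  moreover have "\<phi> \<in> W"
    using \<phi> by (simp add: s)
  then have "W \<in> Zar_basic V \<phi> \<inter> pc_rings V v \<delta>"
    using W pc_rings_subset_Zar by (auto simp: Zar_basic_def)
  moreover have "Zar_basic V \<phi> \<inter> pc_rings V v \<delta> \<subseteq> U"
    using ball r(2) by (auto simp: Zar_basic_def)
  ultimately show "\<exists>T. openin (subtopology (zariski_topology V) (pc_rings V v \<delta>)) T \<and> W \<in> T \<and> T \<subseteq> U"
    by blast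
qed

end

lemma openin_zariski_imp_constructible:
  assumes "openin (zariski_topology V) U"
  shows "openin (constructible_topology V) U"
proof (rule generate_topology_on_coarsest)
  show "istopology (openin (constructible_topology V))"
    by simp
  show "generate_topology_on (range (Zar_basic V)) U"
    using assms by (simp add: zariski_topology_def openin_topology_generated_by_iff)
next
  fix B
  assume "B \<in> range (Zar_basic V)"
  then obtain \<phi> where "B = (\<Inter>\<psi>\<in>{\<phi>}. Zar_basic V \<psi>)"
    by auto
  then have "B \<in> Zar_basic_inters V"
    unfolding Zar_basic_inters_def by blast
  then show "openin (constructible_topology V) B"
    using constructible_topology_clopen by blast
qed

theorem theorem3p5:
  fixes V :: "'a::field set" and v :: "'a \<Rightarrow> ereal" and \<delta> :: ereal
  assumes "valuation_domain V"
    and "valuation_rank V = 1"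
    and "associated_valuation V v"
    and "\<delta> \<noteq> -\<infinity>"
  shows "subtopology (zariski_topology V) (pc_rings V v \<delta>)
           = subtopology (constructible_topology V) (pc_rings V v \<delta>)
       \<and> subtopology (constructible_topology V) (pc_rings V v \<delta>)
           = Metric_space.mtopology (pc_rings V v \<delta>) (pc_dist V v \<delta>)"
proof -
  interpret breadth_space V v \<delta>
    using assms by unfold_locales
  let ?Z = "subtopology (zariski_topology V) (pc_rings V v \<delta>)"
  let ?C = "subtopology (constructible_topology V) (pc_rings V v \<delta>)"
  \<comment> \<open>The inclusions form a cycle: Zariski into constructible, constructible into
    metric, metric into Zariski.\<close>
  have "openin ?C U" if "openin ?Z U" for U
    using that openin_zariski_imp_constructible unfolding openin_subtopology by blast
  moreover have "openin mtopology U" if "openin ?C U" for U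
    using that openin_constructible_imp_metric unfolding openin_subtopology by blast
  ultimately show ?thesis
    using openin_metric_imp_zariski unfolding topology_eq by blast
qed

end
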